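(* Let $\alpha_1 \approx -2.4812$ be the smallest real root of the polynomial $x^3+2x^2-2x-2$. There exists an integer $N$ such that for every integer $k \geq N$ there are infinitely many (pairwise non-isomorphic) $k$-regular graphs whose smallest eigenvalue lies in the half-open interval $[\alpha_1, -1-\sqrt{2})$.
   Context: All graphs are finite, undirected, without loops and without multiple edges. The eigenvalues of a graph are the eigenvalues of its adjacency matrix. A graph is $k$-regular if every vertex has exactly $k$ neighbours. *)

theory Defs
  imports
    "Graph_Theory.Pair_Digraph"
    "Graph_Theory.Digraph_Isomorphism"
    "Jordan_Normal_Form.Spectral_Radius"
begin

text \<open>
  Finite simple undirected graphs are the symmetric loop-free digraphs without parallel arcs
  of the locale \<^locale>\<open>pair_graph\<close>: an undirected edge \<open>{u, v}\<close> is the pair of arcs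
  \<open>(u, v)\<close>, \<open>(v, u)\<close>.
\<close>

definition regular_graph :: "nat \<Rightarrow> 'a pair_pre_digraph \<Rightarrow> bool" where
  "regular_graph k G \<longleftrightarrow>
     pair_graph G \<and> (\<forall>v \<in> pverts G. card {w \<in> pverts G. (v, w) \<in> parcs G} = k)"

text \<open>
  Rows and columns follow the increasing enumeration of the vertices; any other enumeration
  gives a permutation-similar matrix.
\<close>
definition adjacency_matrix :: "'a::linorder pair_pre_digraph \<Rightarrow> real mat" where
  "adjacency_matrix G =
     (let vs = sorted_list_of_set (pverts G); n = card (pverts G)
      in mat n n (\<lambda>(i, j). if (vs ! i, vs ! j) \<in> parcs G then 1 else 0))"

text \<open>
  The matrix is real symmetric, so its real eigenvalues are all its eigenvalues. As a relation
  (rather than \<^const>\<open>Min\<close> of the spectrum), it fails for the null graph, whose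
  spectrum is empty.
\<close>
definition is_smallest_eigenvalue :: "'a::linorder pair_pre_digraph \<Rightarrow> real \<Rightarrow> bool" where
  "is_smallest_eigenvalue G \<theta> \<longleftrightarrow>
     \<theta> \<in> spectrum (adjacency_matrix G) \<and> (\<forall>\<mu> \<in> spectrum (adjacency_matrix G). \<theta> \<le> \<mu>)"

definition alpha1 :: real where
  "alpha1 = Min {x :: real. x ^ 3 + 2 * x ^ 2 - 2 * x - 2 = 0}"

lemma finite_alpha1_roots: "finite {x :: real. x ^ 3 + 2 * x ^ 2 - 2 * x - 2 = 0}"
proof -
  have "{x :: real. x ^ 3 + 2 * x ^ 2 - 2 * x - 2 = 0} = {x. poly [:-2, -2, 2, 1:] x = 0}"
    by (auto simp: algebra_simps power2_eq_square power3_eq_cube)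
  then show ?thesis
    using poly_roots_finite[of "[:-2, -2, 2, 1 :: real:]"] by simp
qed

lemma alpha1_bounds: "-2.4813 < alpha1" "alpha1 < -2.4811"
proof -
  let ?p = "\<lambda>x :: real. x ^ 3 + 2 * x ^ 2 - 2 * x - 2"
  have "\<exists>x. -2.4813 \<le> x \<and> x \<le> -2.4811 \<and> ?p x = 0"
    by (rule IVT') (auto simp: power2_eq_square power3_eq_cube intro!: continuous_intros)
  then obtain r where r: "r \<le> -2.4811" "?p r = 0"
    by blast
  have "alpha1 \<le> r"
    unfolding alpha1_def using finite_alpha1_roots r by (intro Min_le) auto
  moreover have "r \<noteq> -2.4811"
    using r(2) by (auto simp: power2_eq_square power3_eq_cube)
  ultimately show "alpha1 < -2.4811"
    using r(1) by linarith
  have root: "?p alpha1 = 0"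
    using Min_in[OF finite_alpha1_roots] r unfolding alpha1_def by blast
  show "-2.4813 < alpha1"
  proof (rule ccontr)
    assume "\<not> -2.4813 < alpha1"
    define s where "s = - 2.4813 - alpha1"
    have "s \<ge> 0"
      using \<open>\<not> -2.4813 < alpha1\<close> by (simp add: s_def)
    have "?p (- 2.4813 - s) = 0"
      using root by (simp add: s_def)
    then have "?p (- 2.4813) =
        (3 * 2.4813 ^ 2 - 4 * 2.4813 - 2) * s + (3 * 2.4813 - 2) * s ^ 2 + s ^ 3"
      by (simp add: power2_eq_square power3_eq_cube field_simps)
    also have "\<dots> \<ge> 0"
      using \<open>s \<ge> 0\<close> by (intro add_nonneg_nonneg mult_nonneg_nonneg) (auto simp: power2_eq_square)
    finally show False
      by (simp add: power2_eq_square power3_eq_cube)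
  qed
qed

end

theory Submission
  imports Defs
begin

text \<open>
  The number \<open>1 + alpha1\<close> is the smallest eigenvalue of the paw, the triangle with a pendant edge.
  Take \<open>n\<close> disjoint paws and, for each vertex \<open>s\<close> of the paw, partition the \<open>n\<close> copies of \<open>s\<close> into
  cliques of size \<open>k + 1 - deg s\<close>; this makes the graph \<open>k\<close>-regular. Its adjacency matrix plus the
  identity is the sum of the adjacency matrix of the paws and a positive semidefinite matrix (an
  equivalence relation), so its eigenvalues are at least \<open>alpha1\<close>. The bound is attained: put an
  eigenvector of the paw on one copy and its negative on another copy lying in the same four
  cliques.
\<close>

section \<open>The graph built from paws and cliques\<close>

definition paw :: "nat \<Rightarrow> nat \<Rightarrow> bool" where
  "paw s t \<longleftrightarrow> (s, t) \<in> {(0,1), (1,0), (0,2), (2,0), (0,3), (3,0), (1,2), (2,1)}"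

text \<open>The vertex \<open>4 * i + s\<close> is the copy of \<open>s\<close> in the \<open>i\<close>-th paw.\<close>
definition clique_of :: "(nat \<Rightarrow> nat) \<Rightarrow> nat \<Rightarrow> nat \<times> nat" where
  "clique_of c u = (u mod 4, u div 4 div c (u mod 4))"

text \<open>Paw edges join different residues modulo 4 and clique edges equal ones, so no edge
  arises twice: degrees and quadratic forms of the two parts simply add.\<close>

definition paws_adj :: "(nat \<Rightarrow> nat) \<Rightarrow> nat \<Rightarrow> nat \<Rightarrow> bool" where
  "paws_adj c u w \<longleftrightarrow>
     u div 4 = w div 4 \<and> paw (u mod 4) (w mod 4) \<or> u \<noteq> w \<and> clique_of c u = clique_of c w"

definition paws_graph :: "(nat \<Rightarrow> nat) \<Rightarrow> nat \<Rightarrow> nat pair_pre_digraph" where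
  "paws_graph c n =
     \<lparr>pverts = {..<4 * n}, parcs = {(u, w). u < 4 * n \<and> w < 4 * n \<and> paws_adj c u w}\<rparr>"

lemma paw_irrefl: "\<not> paw s s"
  by (auto simp: paw_def)

lemma paw_sym: "paw s t \<Longrightarrow> paw t s"
  by (auto simp: paw_def)

lemma paws_adj_sym: "paws_adj c u w \<Longrightarrow> paws_adj c w u"
  by (auto simp: paws_adj_def paw_sym)

lemma pverts_paws_graph [simp]: "pverts (paws_graph c n) = {..<4 * n}"
  by (simp add: paws_graph_def)

lemma pair_graph_paws_graph: "pair_graph (paws_graph c n)"
proof
  show "symmetric (with_proj (paws_graph c n))"
    by (auto simp: symmetric_def sym_def paws_graph_def dest: paws_adj_sym)
  show "finite (parcs (paws_graph c n))"
    by (rule finite_subset[of _ "{..<4 * n} \<times> {..<4 * n}"]) (auto simp: paws_graph_def)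
qed (auto simp: paws_graph_def paws_adj_def paw_irrefl)

section \<open>Regularity\<close>

lemma card_paw: "s < 4 \<Longrightarrow> card {t. paw s t} = (if s = 0 then 3 else if s = 3 then 1 else 2)"
proof -
  assume "s < 4"
  then consider "s = 0" | "s = 1" | "s = 2" | "s = 3"
    by linarith
  moreover have "{t. paw 0 t} = {1, 2, 3}" "{t. paw 1 t} = {0, 2}"
    "{t. paw 2 t} = {0, 1}" "{t. paw 3 t} = {0}"
    by (simp_all add: paw_def set_eq_iff)
  ultimately show ?thesis
    by cases (simp_all del: One_nat_def)
qed

text \<open>The neighbours of \<open>v\<close> are its paw neighbours and the rest of its clique;
  the \<open>+ 1\<close> accounts for \<open>v\<close> itself, which belongs to that clique.\<close>

lemma card_paws_adj:
  assumes v: "v < 4 * n" and dvd: "c (v mod 4) dvd n" and pos: "c (v mod 4) > 0"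
  shows "card {w. w < 4 * n \<and> paws_adj c v w} + 1 = card {t. paw (v mod 4) t} + c (v mod 4)"
proof -
  define i s where "i = v div 4" and "s = v mod 4"
  have vi: "i < n" "s < 4" "v = 4 * i + s"
    using v by (auto simp: i_def s_def)
  define q where "q = i div c s"
  let ?P = "(\<lambda>t. 4 * i + t) ` {t. paw s t}"
  let ?K = "(\<lambda>j. 4 * j + s) ` {q * c s ..< q * c s + c s}"
  have cs: "c s > 0" "c s dvd n"
    using pos dvd by (auto simp: s_def)
  have lt4: "paw s t \<Longrightarrow> t < 4" for t
    by (auto simp: paw_def)
  have block: "j div c s = q \<longleftrightarrow> j \<in> {q * c s ..< q * c s + c s}" for j
  proof -
    have "j div c s = q \<longleftrightarrow> q \<le> j div c s \<and> j div c s < q + 1"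
      by auto
    also have "\<dots> \<longleftrightarrow> j \<in> {q * c s ..< q * c s + c s}"
      using cs(1) by (simp add: less_eq_div_iff_mult_less_eq div_less_iff_less_mult algebra_simps)
    finally show ?thesis .
  qed
  \<comment> \<open>As \<open>c s\<close> divides \<open>n\<close>, no block is cut off at
    \<open>n\<close>, so the clique of \<open>v\<close> has full size.\<close>
  have "q * c s + c s \<le> n"
  proof -
    obtain m where m: "n = c s * m"
      using cs by auto
    then have "q < m"
      using vi(1) cs(1) by (simp add: q_def div_less_iff_less_mult mult.commute)
    then have "Suc q * c s \<le> m * c s"
      by (intro mult_right_mono) auto
    then show ?thesis
      by (simp add: m mult.commute)
  qed
  then have block_less: "j div c s = q \<Longrightarrow> j < n" for j
    using block[of j] by auto
  have "{w. w < 4 * n \<and> paws_adj c v w} = ?P \<union> (?K - {v})"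
  proof (rule Set.set_eqI)
    fix w :: nat
    have "w \<in> ?P \<longleftrightarrow> w div 4 = i \<and> paw s (w mod 4)"
    proof
      assume "w \<in> ?P"
      then obtain t where "paw s t" "w = 4 * i + t"
        by blast
      then show "w div 4 = i \<and> paw s (w mod 4)"
        using lt4[of t] by simp
    next
      assume w: "w div 4 = i \<and> paw s (w mod 4)"
      then have "w = 4 * i + w mod 4"
        by auto
      then show "w \<in> ?P"
        using w by blast
    qed
    moreover have "w \<in> ?K \<longleftrightarrow> w mod 4 = s \<and> w div 4 div c s = q"
    proof
      assume "w \<in> ?K"
      then obtain j where "j div c s = q" "w = 4 * j + s"
        using block by blast
      then show "w mod 4 = s \<and> w div 4 div c s = q"
        using vi(2) by simp
    next
      assume w: "w mod 4 = s \<and> w div 4 div c s = q"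
      then have "w = 4 * (w div 4) + s"
        by auto
      moreover have "w div 4 \<in> {q * c s ..< q * c s + c s}"
        using w block by blast
      ultimately show "w \<in> ?K"
        by blast
    qed
    moreover have "w < 4 * n" if "w div 4 = i \<or> w div 4 div c s = q"
      using that block_less[of "w div 4"] vi(1) by auto
    moreover have "paws_adj c v w \<longleftrightarrow>
        w div 4 = i \<and> paw s (w mod 4) \<or> w \<noteq> v \<and> w mod 4 = s \<and> w div 4 div c s = q"
      unfolding paws_adj_def clique_of_def q_def i_def s_def by auto
    ultimately show "w \<in> {w. w < 4 * n \<and> paws_adj c v w} \<longleftrightarrow> w \<in> ?P \<union> (?K - {v})"
      by blast
  qed
  moreover have "?P \<inter> (?K - {v}) = {}"
  proof -
    have False if "4 * i + t = 4 * j + s" "paw s t" for t j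
    proof -
      have "(4 * i + t) mod 4 = (4 * j + s) mod 4"
        using that(1) by (rule arg_cong)
      then have "t = s"
        using lt4[OF that(2)] vi(2) by simp
      then show False
        using that(2) paw_irrefl by simp
    qed
    then show ?thesis
      by blast
  qed
  moreover have "finite ?P"
    by (rule finite_imageI, rule finite_subset[of _ "{..<4}"]) (auto dest: lt4)
  moreover have "card ?P = card {t. paw s t}"
    by (intro card_image) (auto simp: inj_on_def)
  moreover have "card ?K = c s"
    by (subst card_image) (auto simp: inj_on_def)
  moreover have "v \<in> ?K"
    using block[of i] vi(3) by (auto simp: q_def)
  ultimately show ?thesis
    using cs(1) by (simp add: card_Un_disjoint s_def)
qed

lemma regular_paws_graph:
  assumes "\<And>s. s < 4 \<Longrightarrow> c s dvd n" "\<And>s. s < 4 \<Longrightarrow> c s > 0"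
    and "\<And>s. s < 4 \<Longrightarrow> card {t. paw s t} + c s = k + 1"
  shows "regular_graph k (paws_graph c n)"
proof -
  have "card {w \<in> {..<4 * n}. (v, w) \<in> parcs (paws_graph c n)} = k" if "v < 4 * n" for v
  proof -
    have "{w \<in> {..<4 * n}. (v, w) \<in> parcs (paws_graph c n)} = {w. w < 4 * n \<and> paws_adj c v w}"
      using that by (auto simp: paws_graph_def)
    then show ?thesis
      using card_paws_adj[of v n c] assms[of "v mod 4"] that by simp
  qed
  then show ?thesis
    by (simp add: regular_graph_def pair_graph_paws_graph)
qed

section \<open>The adjacency matrix and a lower bound for its eigenvalues\<close>

lemma adjacency_paws_graph:
  "adjacency_matrix (paws_graph c n) = mat (4 * n) (4 * n) (\<lambda>(i, j). of_bool (paws_adj c i j))"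
proof -
  have "sorted_list_of_set {..<4 * n} = [0..<4 * n]"
    by (simp add: lessThan_atLeast0)
  then show ?thesis
    by (intro eq_matI) (auto simp: adjacency_matrix_def Let_def paws_graph_def)
qed

text \<open>\<open>Min\<close> is meaningful only on a nonempty set, so a root is first produced by
  the intermediate value theorem.\<close>

lemma alpha1_root: "alpha1 ^ 3 + 2 * alpha1 ^ 2 - 2 * alpha1 - 2 = 0"
proof -
  let ?p = "\<lambda>x :: real. x ^ 3 + 2 * x ^ 2 - 2 * x - 2"
  have "\<exists>x. -2.4813 \<le> x \<and> x \<le> -2.4811 \<and> ?p x = 0"
    by (rule IVT') (auto simp: power2_eq_square power3_eq_cube intro!: continuous_intros)
  then have "{x. ?p x = 0} \<noteq> {}"
    by blast
  then show ?thesis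
    using Min_in[OF finite_alpha1_roots] unfolding alpha1_def by blast
qed

text \<open>Completing squares, first in the pendant variable \<open>w\<close>, then in
  \<open>y + z\<close> for the two twins of the triangle, leaves a multiple of
  \<open>x\<^sup>2\<close> whose coefficient is the cubic that vanishes at \<open>p\<close>.\<close>

lemma paw_form_ge:
  fixes x y z w :: real
  shows "(1 + alpha1) * (x\<^sup>2 + y\<^sup>2 + z\<^sup>2 + w\<^sup>2) \<le> 2 * (x * y + x * z + x * w + y * z)"
proof -
  define p where "p = - 1 - alpha1"
  have p: "p > 1" "p ^ 3 + p ^ 2 - 3 * p - 1 = 0"
    using alpha1_bounds alpha1_root
    by (auto simp: p_def power2_eq_square power3_eq_cube algebra_simps)
  \<comment> \<open>The factor \<open>2 * p * (p + 1)\<close> clears the denominators of the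
    completed squares.\<close>
  have "p * (p * (x\<^sup>2 + y\<^sup>2 + z\<^sup>2 + w\<^sup>2) + 2 * (x * y + x * z + x * w + y * z)) * (2 * (p + 1)) =
      2 * (p + 1) * (p * w + x)\<^sup>2 + p * (2 * x + (p + 1) * (y + z))\<^sup>2
      + p * (p + 1) * (p - 1) * (y - z)\<^sup>2 + 2 * x\<^sup>2 * (p ^ 3 + p ^ 2 - 3 * p - 1)"
    by (simp add: power2_eq_square power3_eq_cube algebra_simps)
  also have "\<dots> \<ge> 0"
    using p by simp
  finally have "p * (x\<^sup>2 + y\<^sup>2 + z\<^sup>2 + w\<^sup>2) + 2 * (x * y + x * z + x * w + y * z) \<ge> 0"
    using p(1) by (simp add: zero_le_mult_iff)
  then show ?thesis
    by (simp add: p_def algebra_simps)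
qed

text \<open>Grouped by the classes of \<open>g\<close>, the form is a sum of squares of the class
  sums of \<open>f\<close>.\<close>

lemma equivalence_form_nonneg:
  fixes f :: "'a \<Rightarrow> real"
  assumes "finite V"
  shows "0 \<le> (\<Sum>u\<in>V. \<Sum>w\<in>V. of_bool (g u = g w) * f u * f w)"
proof -
  have "(\<Sum>u\<in>V. \<Sum>w\<in>V. of_bool (g u = g w) * f u * f w) =
      (\<Sum>u\<in>V. f u * (\<Sum>w | w \<in> V \<and> g w = g u. f w))"
  proof (intro sum.cong refl)
    fix u
    have "(\<Sum>w | w \<in> V \<and> g w = g u. f w) = (\<Sum>w\<in>V. if g w = g u then f w else 0)"
      using assms by (simp add: sum.inter_filter)
    then show "(\<Sum>w\<in>V. of_bool (g u = g w) * f u * f w) =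
        f u * (\<Sum>w | w \<in> V \<and> g w = g u. f w)"
      by (auto simp: sum_distrib_left intro!: sum.cong)
  qed
  also have "\<dots> = (\<Sum>y\<in>g ` V. \<Sum>u | u \<in> V \<and> g u = y. f u * (\<Sum>w | w \<in> V \<and> g w = g u. f w))"
    using assms by (rule sum.image_gen)
  also have "\<dots> = (\<Sum>y\<in>g ` V. (\<Sum>u | u \<in> V \<and> g u = y. f u)\<^sup>2)"
    by (intro sum.cong refl) (simp add: power2_eq_square sum_distrib_right)
  also have "\<dots> \<ge> 0"
    by (intro sum_nonneg) simp
  finally show ?thesis .
qed

lemma sum_lessThan_4: "(\<Sum>t<4. f t) = f 0 + f 1 + f 2 + f (3 :: nat)" for f :: "nat \<Rightarrow> real"
  by (simp add: numeral_eq_Suc)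

lemma sum_paws:
  fixes f :: "nat \<Rightarrow> real"
  shows "(\<Sum>u<4 * n. f u) = (\<Sum>i<n. \<Sum>t<4. f (4 * i + t))"
proof -
  have "sum f {i * 4..<i * 4 + 4} = (\<Sum>t<4. f (4 * i + t))" for i
    using sum.shift_bounds_nat_ivl[of f 0 "i * 4" 4] by (simp add: lessThan_atLeast0 ac_simps)
  then show ?thesis
    using sum.nat_group[of f 4 n] by (simp add: mult.commute)
qed

lemma paw_form_eq:
  fixes g :: "nat \<Rightarrow> real"
  shows "(\<Sum>s<4. \<Sum>t<4. of_bool (paw s t) * g s * g t) =
    2 * (g 0 * g 1 + g 0 * g 2 + g 0 * g 3 + g 1 * g 2)"
  unfolding sum_lessThan_4 by (simp add: paw_def)

text \<open>The matrix of disjoint paws is block diagonal, so its form splits into one paw form per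
  copy and \<open>paw_form_ge\<close> applies to each.\<close>

lemma paws_form_ge:
  "(1 + alpha1) * (\<Sum>u<4 * n. (f u)\<^sup>2) \<le>
     (\<Sum>u<4 * n. \<Sum>w<4 * n. of_bool (u div 4 = w div 4 \<and> paw (u mod 4) (w mod 4)) * f u * f w)"
proof -
  define P where "P u w \<longleftrightarrow> u div 4 = w div 4 \<and> paw (u mod 4) (w mod 4)" for u w
  have P: "P (4 * i + s) (4 * j + t) \<longleftrightarrow> j = i \<and> paw s t" if "s < 4" "t < 4" for i j s t
    using that by (auto simp: P_def)
  have inner: "(\<Sum>w<4 * n. of_bool (P (4 * i + s) w) * f (4 * i + s) * f w) =
      (\<Sum>t<4. of_bool (paw s t) * f (4 * i + s) * f (4 * i + t))" if "i < n" "s < 4" for i s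
  proof -
    have "(\<Sum>w<4 * n. of_bool (P (4 * i + s) w) * f (4 * i + s) * f w) =
        (\<Sum>j<n. if j = i then \<Sum>t<4. of_bool (paw s t) * f (4 * i + s) * f (4 * i + t) else 0)"
      unfolding sum_paws
    proof (intro sum.cong refl)
      fix j
      show "(\<Sum>t<4. of_bool (P (4 * i + s) (4 * j + t)) * f (4 * i + s) * f (4 * j + t)) =
          (if j = i then \<Sum>t<4. of_bool (paw s t) * f (4 * i + s) * f (4 * i + t) else 0)"
        by (cases "j = i") (simp_all add: P[OF \<open>s < 4\<close>] cong: sum.cong_simp)
    qed
    then show ?thesis
      using that by simp
  qed
  have "(1 + alpha1) * (\<Sum>u<4 * n. (f u)\<^sup>2) =
      (\<Sum>i<n. (1 + alpha1) * (\<Sum>s<4. (f (4 * i + s))\<^sup>2))"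
    unfolding sum_paws sum_distrib_left ..
  also have "\<dots> \<le> (\<Sum>i<n. \<Sum>s<4. \<Sum>t<4. of_bool (paw s t) * f (4 * i + s) * f (4 * i + t))"
  proof (rule sum_mono)
    fix i
    show "(1 + alpha1) * (\<Sum>s<4. (f (4 * i + s))\<^sup>2) \<le>
        (\<Sum>s<4. \<Sum>t<4. of_bool (paw s t) * f (4 * i + s) * f (4 * i + t))"
      unfolding paw_form_eq[of "\<lambda>s. f (4 * i + s)"]
      unfolding sum_lessThan_4 by (rule paw_form_ge)
  qed
  also have "\<dots> = (\<Sum>u<4 * n. \<Sum>w<4 * n. of_bool (P u w) * f u * f w)"
    unfolding sum_paws[of "\<lambda>u. \<Sum>w<4 * n. of_bool (P u w) * f u * f w"]
    by (rule sum.cong[OF refl], rule sum.cong[OF refl]) (simp add: inner)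
  finally show ?thesis
    unfolding P_def .
qed

lemma paws_adj_form_ge:
  "alpha1 * (\<Sum>u<4 * n. (f u)\<^sup>2) \<le> (\<Sum>u<4 * n. \<Sum>w<4 * n. of_bool (paws_adj c u w) * f u * f w)"
proof -
  let ?P = "\<lambda>u w. u div 4 = w div 4 \<and> paw (u mod 4) (w mod 4)"
  let ?K = "\<lambda>u w. clique_of c u = clique_of c w"
  \<comment> \<open>The clique relation is reflexive and adjacency is not; subtracting this diagonal
    turns the bound \<open>1 + alpha1\<close> into \<open>alpha1\<close>.\<close>
  have split: "of_bool (paws_adj c u w) * f u * f w =
      of_bool (?P u w) * f u * f w + of_bool (?K u w) * f u * f w - (if u = w then (f u)\<^sup>2 else 0)"
    for u w
    using paw_irrefl by (auto simp: paws_adj_def clique_of_def power2_eq_square)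
  have "(\<Sum>u<4 * n. \<Sum>w<4 * n. of_bool (paws_adj c u w) * f u * f w) =
      (\<Sum>u<4 * n. \<Sum>w<4 * n. of_bool (?P u w) * f u * f w)
      + (\<Sum>u<4 * n. \<Sum>w<4 * n. of_bool (?K u w) * f u * f w) - (\<Sum>u<4 * n. (f u)\<^sup>2)"
    unfolding split by (simp add: sum.distrib sum_subtractf)
  then show ?thesis
    using paws_form_ge[of f n] equivalence_form_nonneg[of "{..<4 * n}" "clique_of c" f]
    by (simp add: algebra_simps)
qed

text \<open>Rayleigh quotient: pairing an eigenvector with itself gives \<mu> times its squared
  norm, and the form bound applies.\<close>

lemma eigenvalue_paws_graph_ge:
  assumes "eigenvalue (adjacency_matrix (paws_graph c n)) \<mu>"
  shows "alpha1 \<le> \<mu>"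
proof -
  obtain v where v: "v \<in> carrier_vec (4 * n)" "v \<noteq> 0\<^sub>v (4 * n)"
    "adjacency_matrix (paws_graph c n) *\<^sub>v v = \<mu> \<cdot>\<^sub>v v"
    using assms by (auto simp: eigenvalue_def eigenvector_def adjacency_paws_graph)
  define f where "f u = v $ u" for u
  have row: "(\<Sum>w<4 * n. of_bool (paws_adj c u w) * f w) = \<mu> * f u" if "u < 4 * n" for u
  proof -
    have "(adjacency_matrix (paws_graph c n) *\<^sub>v v) $ u = (\<mu> \<cdot>\<^sub>v v) $ u"
      by (simp add: v(3))
    then show ?thesis
      using that v(1)
      by (simp add: adjacency_paws_graph scalar_prod_def f_def lessThan_atLeast0)
  qed
  have "(\<Sum>u<4 * n. \<Sum>w<4 * n. of_bool (paws_adj c u w) * f u * f w) = \<mu> * (\<Sum>u<4 * n. (f u)\<^sup>2)"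
    unfolding sum_distrib_left
  proof (intro sum.cong refl)
    fix u assume "u \<in> {..<4 * n}"
    then have "f u * (\<Sum>w<4 * n. of_bool (paws_adj c u w) * f w) = f u * (\<mu> * f u)"
      using row[of u] by (metis lessThan_iff)
    moreover have "f u * (\<Sum>w<4 * n. of_bool (paws_adj c u w) * f w) =
        (\<Sum>w<4 * n. of_bool (paws_adj c u w) * f u * f w)"
      unfolding sum_distrib_left by (intro sum.cong refl) simp
    ultimately show "(\<Sum>w<4 * n. of_bool (paws_adj c u w) * f u * f w) = \<mu> * (f u)\<^sup>2"
      by (metis mult.left_commute power2_eq_square)
  qed
  then have le: "alpha1 * (\<Sum>u<4 * n. (f u)\<^sup>2) \<le> \<mu> * (\<Sum>u<4 * n. (f u)\<^sup>2)"
    using paws_adj_form_ge[of f n c] by simp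
  obtain u where u: "u < 4 * n" "f u \<noteq> 0"
    using v(1,2) by (auto simp: f_def vec_eq_iff)
  then have "(\<Sum>u<4 * n. (f u)\<^sup>2) > 0"
    by (intro sum_pos2[of _ u]) auto
  then show ?thesis
    using le by (simp add: mult_le_cancel_right)
qed

section \<open>The bound is attained\<close>

text \<open>The signed eigenvector lives on copies 0 and 1. They exist because
  \<open>n \<ge> 2\<close>, and lie in the same cliques because \<open>c s \<ge> 2\<close> puts 0
  and 1 in one block.\<close>

lemma eigenvalue_paws_graph_alpha1:
  assumes "n \<ge> 2" and c: "\<And>s. s < 4 \<Longrightarrow> c s \<ge> 2"
  shows "eigenvalue (adjacency_matrix (paws_graph c n)) alpha1"
proof -
  define l where "l = 1 + alpha1"
  have l: "l ^ 3 - l ^ 2 - 3 * l + 1 = 0"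
    using alpha1_root by (auto simp: l_def power2_eq_square power3_eq_cube algebra_simps)
  \<comment> \<open>An eigenvector of the paw for \<open>l\<close>: with the value 2 at the pendant
    vertex and equal values at the twins 1 and 2, the rows of 3 and 0 fix all entries, and the rows
    of the twins then reduce to the cubic for \<open>l\<close>.\<close>
  define x :: "nat \<Rightarrow> real" where
    "x s = (if s = 0 then 2 * l else if s = 3 then 2 else l ^ 2 - 1)" for s
  define \<epsilon> :: "nat \<Rightarrow> real" where "\<epsilon> i = (if i = 0 then 1 else if i = 1 then -1 else 0)" for i
  define f where "f u = \<epsilon> (u div 4) * x (u mod 4)" for u
  have paw_row: "(\<Sum>t<4. (of_bool (paw s t) - of_bool (s = t)) * x t) = alpha1 * x s" if "s < 4" for s
  proof -
    have "alpha1 = l - 1"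
      by (simp add: l_def)
    have "s = 0 \<or> s = 1 \<or> s = 2 \<or> s = 3"
      using that by linarith
    then show ?thesis
      unfolding sum_lessThan_4 \<open>alpha1 = l - 1\<close> using l
      by (elim disjE) (simp_all add: paw_def x_def power2_eq_square power3_eq_cube algebra_simps)
  qed
  have row: "(\<Sum>w<4 * n. of_bool (paws_adj c u w) * f w) = alpha1 * f u" for u
  proof -
    \<comment> \<open>Copies 0 and 1 of \<open>t\<close> share a clique, so the clique terms cancel
      for every \<open>u\<close>. Only the paw and the diagonal correction survive, with sign 1, -1
      or 0 according to the copy containing \<open>u\<close>.\<close>
    have diff: "(of_bool (paws_adj c u t) - of_bool (paws_adj c u (t + 4)) :: real) =
        \<epsilon> (u div 4) * (of_bool (paw (u mod 4) t) - of_bool (u mod 4 = t))" if t: "t < 4" for t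
    proof -
      have "0 div c t = 0" "1 div c t = 0"
        using c[OF t] by auto
      then have same: "clique_of c (t + 4) = clique_of c t"
        using t by (simp add: clique_of_def)
      have div: "t div 4 = 0" "(t + 4) div 4 = 1" "t mod 4 = t" "(t + 4) mod 4 = t"
        using t by auto
      have eq: "u = w \<longleftrightarrow> u div 4 = w div 4 \<and> u mod 4 = w mod 4" for w
        by (metis div_mult_mod_eq)
      have adj: "(of_bool (paws_adj c u w) :: real) =
          of_bool (u div 4 = w div 4 \<and> paw (u mod 4) (w mod 4))
          + of_bool (clique_of c u = clique_of c w)
          - of_bool (u div 4 = w div 4 \<and> u mod 4 = w mod 4)" for w
        unfolding paws_adj_def eq using paw_irrefl by (auto simp: clique_of_def)
      show ?thesis
        unfolding adj same div by (auto simp: \<epsilon>_def)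
    qed
    define g where "g i = (\<Sum>t<4. of_bool (paws_adj c u (4 * i + t)) * x t)" for i
    have "(\<Sum>w<4 * n. of_bool (paws_adj c u w) * f w) = (\<Sum>i<n. \<epsilon> i * g i)"
      unfolding sum_paws g_def sum_distrib_left by (intro sum.cong refl) (simp add: f_def)
    also have "\<dots> = (\<Sum>i<2. \<epsilon> i * g i)"
      using assms(1) by (intro sum.mono_neutral_right) (auto simp: \<epsilon>_def)
    also have "\<dots> = g 0 - g 1"
      by (simp add: \<epsilon>_def numeral_2_eq_2)
    also have "\<dots> = (\<Sum>t<4. (of_bool (paws_adj c u t) - of_bool (paws_adj c u (t + 4))) * x t)"
      by (simp add: g_def sum_subtractf left_diff_distrib add.commute)
    also have "\<dots> = \<epsilon> (u div 4) * (\<Sum>t<4. (of_bool (paw (u mod 4) t) - of_bool (u mod 4 = t)) * x t)"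
      unfolding sum_distrib_left using diff by (intro sum.cong refl) simp
    also have "\<dots> = alpha1 * f u"
      by (simp add: paw_row f_def)
    finally show ?thesis .
  qed
  \<comment> \<open>Coordinate 3 is the pendant vertex of copy 0, where the value is 2 whatever
    \<open>l\<close> is.\<close>
  have "vec (4 * n) f $ 3 \<noteq> 0"
    using assms(1) by (simp add: f_def x_def \<epsilon>_def)
  then have "vec (4 * n) f $ 3 \<noteq> 0\<^sub>v (4 * n) $ 3"
    using assms(1) by simp
  then have "vec (4 * n) f \<noteq> 0\<^sub>v (4 * n)"
    by metis
  moreover have "adjacency_matrix (paws_graph c n) *\<^sub>v vec (4 * n) f = alpha1 \<cdot>\<^sub>v vec (4 * n) f"
    using row by (intro eq_vecI)
      (auto simp: adjacency_paws_graph scalar_prod_def lessThan_atLeast0)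
  ultimately have "eigenvector (adjacency_matrix (paws_graph c n)) (vec (4 * n) f) alpha1"
    by (simp add: eigenvector_def adjacency_paws_graph)
  then show ?thesis
    unfolding eigenvalue_def by blast
qed

section \<open>The infinite family, separated by the number of vertices\<close>

lemma digraph_iso_card:
  assumes "digraph_iso G H"
  shows "card (verts G) = card (verts H)"
proof -
  obtain h where "inj_on (iso_verts h) (verts G)" "H = app_iso h G"
    using assms by (auto simp: digraph_iso_def pre_digraph.digraph_isomorphism_def)
  then show ?thesis
    by (simp add: card_image)
qed

theorem theorem1p6:
  shows "\<exists>N :: nat. \<forall>k \<ge> N. \<exists>\<G> :: nat pair_pre_digraph set.
           infinite \<G> \<and>
           (\<forall>G \<in> \<G>. regular_graph k G \<and>
              (\<exists>\<theta>. is_smallest_eigenvalue G \<theta> \<and> alpha1 \<le> \<theta> \<and> \<theta> < - 1 - sqrt 2)) \<and>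
           (\<forall>G \<in> \<G>. \<forall>H \<in> \<G>. G \<noteq> H \<longrightarrow> \<not> digraph_iso (with_proj G) (with_proj H))"
\<comment> \<open>The smallest clique size is \<open>k - 2\<close>, and \<open>k \<ge> 4\<close>
  makes it at least 2.\<close>
proof (intro exI[of _ 4] allI impI)
  fix k :: nat assume k: "4 \<le> k"
  define c where "c s = k + 1 - card {t. paw s t}" for s
  \<comment> \<open>A common multiple of the three clique sizes; \<open>Suc m\<close> keeps it
    positive and yields infinitely many orders.\<close>
  define n where "n m = Suc m * ((k - 2) * (k - 1) * k)" for m
  define \<G> where "\<G> = range (\<lambda>m. paws_graph c (n m))"
  have c: "c s = (if s = 0 then k - 2 else if s = 3 then k else k - 1)" if "s < 4" for s
    using that k by (simp add: c_def card_paw)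
  have ge2: "c s \<ge> 2" if "s < 4" for s
    unfolding c[OF that] using k by auto
  have "2 * 1 * 1 \<le> (k - 2) * (k - 1) * k"
    using k by (intro mult_le_mono) auto
  then have n2: "n m \<ge> 2" for m
    by (simp add: n_def)
  have "inj n"
    using k by (auto simp: inj_def n_def)
  have regular: "regular_graph k (paws_graph c (n m))" for m
  proof (rule regular_paws_graph)
    fix s :: nat assume "s < 4"
    then show "c s dvd n m"
      by (auto simp: c n_def)
    show "c s > 0"
      using ge2[OF \<open>s < 4\<close>] by simp
    show "card {t. paw s t} + c s = k + 1"
      using \<open>s < 4\<close> k by (auto simp: c card_paw)
  qed
  have smallest: "is_smallest_eigenvalue (paws_graph c (n m)) alpha1" for m
    using eigenvalue_paws_graph_alpha1[of "n m" c] eigenvalue_paws_graph_ge n2 ge2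
    by (auto simp: is_smallest_eigenvalue_def spectrum_def)
  \<comment> \<open>1.4811 is what remains of the bound \<open>alpha1 < -2.4811\<close> after moving
    the 1 across.\<close>
  have "sqrt 2 < 14811 / 10000"
    by (rule real_less_lsqrt) (auto simp: power2_eq_square)
  moreover have "alpha1 < - 24811 / 10000"
    using alpha1_bounds(2) by simp
  ultimately have "alpha1 < - 1 - sqrt 2"
    by linarith
  have card: "card (pverts (paws_graph c (n m))) = 4 * n m" for m
    by simp
  have "inj (\<lambda>m. paws_graph c (n m))"
    using \<open>inj n\<close> card by (metis (no_types, lifting) inj_def mult_left_cancel zero_neq_numeral)
  then have "infinite \<G>"
    by (simp add: \<G>_def finite_image_iff)
  moreover have "\<not> digraph_iso (with_proj G) (with_proj H)"
    if "G \<in> \<G>" "H \<in> \<G>" "G \<noteq> H" for G H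
    using that digraph_iso_card[of "with_proj G" "with_proj H"] by (auto simp: \<G>_def)
  ultimately show "\<exists>\<G> :: nat pair_pre_digraph set. infinite \<G> \<and>
      (\<forall>G \<in> \<G>. regular_graph k G \<and>
         (\<exists>\<theta>. is_smallest_eigenvalue G \<theta> \<and> alpha1 \<le> \<theta> \<and> \<theta> < - 1 - sqrt 2)) \<and>
      (\<forall>G \<in> \<G>. \<forall>H \<in> \<G>. G \<noteq> H \<longrightarrow> \<not> digraph_iso (with_proj G) (with_proj H))"
    using regular smallest \<open>alpha1 < - 1 - sqrt 2\<close>
    by (intro exI[of _ \<G>]) (auto simp: \<G>_def)
qed

end
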